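(* Let $p$ be an odd prime with $p \equiv 3 \pmod 4$, let $m \geq 1$ be an integer, and let $t \in \mathbb{Z}_p$. Then $$ N_{2m}(t, p) = \begin{cases} p^{2m-1} + (-1)^m p^m + (-1)^{m-1} p^{m-1} & \text{if } t = 0, \\ p^{2m-1} + (-1)^{m-1} p^{m-1} & \text{if } t \neq 0. \end{cases} $$
   Context: $\mathbb{Z}_p$ denotes the ring of integers modulo $p$. For $t \in \mathbb{Z}_p$, $N_j(t,p)$ is the number of ordered $j$-tuples $(x_1,\dots,x_j) \in \mathbb{Z}_p^j$ with $\sum_{i=1}^j x_i^2 = t$ in $\mathbb{Z}_p$ (zero entries are allowed). *)

theory Defs
  imports "HOL-Number_Theory.Residues" "HOL-Library.FuncSet"
begin

text \<open>
  The ring of integers modulo \<open>p\<close> is the library's \<^const>\<open>residue_ring\<close>, whose carrier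
  is \<open>{0..p - 1} :: int set\<close>; sums, powers and zero below are those of this ring.
  A \<open>j\<close>-tuple over it is an extensional function on \<open>{1..j}\<close>, so that each tuple is
  counted exactly once.
\<close>

definition N_sq :: "nat \<Rightarrow> int \<Rightarrow> nat \<Rightarrow> nat" where
  "N_sq j t p =
     card {x \<in> {1..j} \<rightarrow>\<^sub>E carrier (residue_ring (int p)).
       (\<Oplus>\<^bsub>residue_ring (int p)\<^esub>i\<in>{1..j}. x i [^]\<^bsub>residue_ring (int p)\<^esub> (2::nat)) = t}"

end

theory Submission
  imports Defs "HOL-Number_Theory.Euler_Criterion"
begin

text \<open>
  Squares are added two at a time. For \<open>p \<equiv> 3 (mod 4)\<close> the residue \<open>- 1\<close> is not a square, so
  the form \<open>x\<^sup>2 + y\<^sup>2\<close> vanishes only at the origin and is the norm form of the field with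
  \<open>p\<^sup>2\<close> elements. It takes every value, and multiplication by an element of norm \<open>v\<close> carries
  the points of norm \<open>u\<close> injectively to those of norm \<open>u v\<close>; hence all nonzero norms are taken
  equally often, which must be \<open>(p\<^sup>2 - 1) / (p - 1) = p + 1\<close> times (\<open>card_circle\<close>).

  Let \<open>N\<^sub>j(u)\<close> be the number of solutions of \<open>x\<^sub>1\<^sup>2 + \<dots> + x\<^sub>j\<^sup>2 = u\<close>. Splitting off two
  coordinates turns the count on circles into the recurrence
  \<open>N\<^sub>j\<^sub>+\<^sub>2(u) = (\<Sum>s. N\<^sub>2(u - s) N\<^sub>j(s)) = (p + 1) p\<^sup>j - p N\<^sub>j(u)\<close>.
  Thus the deviation of \<open>N\<^sub>j(u)\<close> from the average \<open>p\<^sup>j / p\<close> is multiplied by \<open>- p\<close> at each step,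
  and the closed form follows by induction from the empty tuple, which represents only \<open>0\<close>
  (\<open>sphere_card_even\<close>).
\<close>

section \<open>Squares modulo a prime congruent to 3 modulo 4\<close>

text \<open>
  In Euler's criterion the exponent \<open>(p - 1) / 2\<close> is odd, so negating \<open>a\<close> changes the sign of
  its Legendre symbol.
\<close>

lemma QuadRes_uminus_iff:
  fixes p :: nat and a :: int
  assumes p: "prime p" "[p = 3] (mod 4)" and a: "\<not> int p dvd a"
  shows "QuadRes (int p) (- a) \<longleftrightarrow> \<not> QuadRes (int p) a"
proof -
  have mod4: "p mod 4 = 3" using p(2) by (simp add: cong_def)
  have p2: "2 < p" using mod4 prime_ge_2_nat[OF p(1)] by (cases "p = 2") auto
  define h where "h = (p - 1) div 2"
  have "odd h" using mod4 unfolding h_def by presburger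
  have na: "\<not> [a = 0] (mod int p)" "\<not> [- a = 0] (mod int p)"
    using a by (simp_all add: cong_0_iff)
  have "[Legendre (- a) (int p) = (- a) ^ h] (mod int p)"
    unfolding h_def by (rule euler_criterion[OF p(1) p2])
  also have "(- a) ^ h = - (a ^ h)" using \<open>odd h\<close> by simp
  also have "[- (a ^ h) = - Legendre a (int p)] (mod int p)"
    unfolding h_def cong_minus_minus_iff by (rule cong_sym[OF euler_criterion[OF p(1) p2]])
  finally have "int p dvd Legendre (- a) (int p) + Legendre a (int p)"
    by (simp add: cong_iff_dvd_diff)
  moreover have "\<not> int p dvd 2" "\<not> int p dvd - 2"
    using p2 by (auto dest: zdvd_imp_le)
  ultimately show ?thesis
    using na by (auto simp: Legendre_def split: if_splits)
qed

text \<open>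
  The form \<open>a\<^sup>2 + b\<^sup>2\<close> is anisotropic: from a nontrivial zero, both \<open>a\<^sup>2\<close> and
  \<open>- a\<^sup>2 \<equiv> b\<^sup>2\<close> would be nonzero squares.
\<close>

lemma dvd_sum_two_squaresD:
  fixes p :: nat and a b :: int
  assumes p: "prime p" "[p = 3] (mod 4)" and dvd: "int p dvd a\<^sup>2 + b\<^sup>2"
  shows "int p dvd a"
proof (rule ccontr)
  assume a: "\<not> int p dvd a"
  have "prime (int p)" using p(1) by simp
  then have "\<not> int p dvd a\<^sup>2" using a by (simp add: prime_dvd_power_iff)
  moreover have "QuadRes (int p) (a\<^sup>2)" unfolding QuadRes_def by (rule exI[of _ a]) simp
  moreover have "QuadRes (int p) (- (a\<^sup>2))"
    unfolding QuadRes_def using dvd by (intro exI[of _ b]) (simp add: cong_iff_dvd_diff add.commute)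
  ultimately show False using QuadRes_uminus_iff[OF p] by blast
qed

text \<open>
  Otherwise the squares would be closed under adding one, so that every residue, in particular
  \<open>- 1\<close>, would be a square.
\<close>

lemma ex_nonresidue_square_plus_one:
  fixes p :: nat
  assumes p: "prime p" "[p = 3] (mod 4)"
  shows "\<exists>c. \<not> QuadRes (int p) (c\<^sup>2 + 1)"
proof (rule ccontr)
  assume neg: "\<nexists>c. \<not> QuadRes (int p) (c\<^sup>2 + 1)"
  have "QuadRes (int p) (int n)" for n
  proof (induction n)
    case 0
    show ?case unfolding QuadRes_def by (rule exI[of _ 0]) simp
  next
    case (Suc n)
    then obtain c where "[c\<^sup>2 = int n] (mod int p)" unfolding QuadRes_def by blast
    then have "[c\<^sup>2 + 1 = int (Suc n)] (mod int p)"
      using cong_add[of "c\<^sup>2" "int n" "int p" 1 1] by (simp add: add.commute)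
    moreover obtain d where "[d\<^sup>2 = c\<^sup>2 + 1] (mod int p)"
      using neg unfolding QuadRes_def by blast
    ultimately show ?case unfolding QuadRes_def using cong_trans by blast
  qed
  then obtain b where "[b\<^sup>2 = int (p - 1)] (mod int p)" unfolding QuadRes_def by blast
  then have "int p dvd 1\<^sup>2 + b\<^sup>2"
    using prime_ge_1_nat[OF p(1)] 
    by (auto simp: cong_iff_dvd_diff of_nat_diff algebra_simps dest: dvd_add[OF _ dvd_refl])
  from dvd_sum_two_squaresD[OF p this] show False using prime_gt_1_nat[OF p(1)] by simp
qed

text \<open>
  A square is a sum of two squares with one of them zero. Any other \<open>u\<close> differs by a square factor
  from a non-square of the form \<open>c\<^sup>2 + 1\<close>, because the squares have index two among the nonzero
  residues.
\<close>

lemma ex_cong_sum_two_squares: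
  fixes p :: nat and u :: int
  assumes p: "prime p" "[p = 3] (mod 4)"
  shows "\<exists>a b. [a\<^sup>2 + b\<^sup>2 = u] (mod int p)"
proof (cases "QuadRes (int p) u")
  case True
  then obtain a where "[a\<^sup>2 + 0\<^sup>2 = u] (mod int p)" by (auto simp: QuadRes_def)
  then show ?thesis by blast
next
  case False
  have ndvd: "\<not> int p dvd v" if "\<not> QuadRes (int p) v" for v
    using that by (auto simp: QuadRes_def cong_iff_dvd_diff dest: spec[of _ 0])
  obtain c where c: "\<not> QuadRes (int p) (c\<^sup>2 + 1)"
    using ex_nonresidue_square_plus_one[OF p] by blast
  let ?v = "c\<^sup>2 + 1"
  \<comment> \<open>Both \<open>- u\<close> and \<open>- ?v\<close> are squares, so \<open>u\<close> is \<open>?v\<close> times the square of \<open>d / e\<close>;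
    the inverse of \<open>e\<close> is \<open>f\<close> below.\<close>
  obtain d where d: "[d\<^sup>2 = - u] (mod int p)"
    using QuadRes_uminus_iff[OF p ndvd[OF False]] False unfolding QuadRes_def by blast
  obtain e where e: "[e\<^sup>2 = - ?v] (mod int p)"
    using QuadRes_uminus_iff[OF p ndvd[OF c]] c unfolding QuadRes_def by blast
  have "\<not> int p dvd e"
  proof
    assume "int p dvd e"
    then have "int p dvd e\<^sup>2" by (simp add: power2_eq_square)
    then show False using ndvd[OF c] cong_dvd_iff[OF e] dvd_minus_iff by blast
  qed
  then have "coprime e (int p)"
    using p(1) prime_imp_coprime[of "int p" e] by (simp add: coprime_commute)
  then obtain f where f: "[e * f = 1] (mod int p)" using cong_solve_coprime_int by blast
  have "[(c * (d * f))\<^sup>2 + (d * f)\<^sup>2 = - (d\<^sup>2 * f\<^sup>2 * (- ?v))] (mod int p)"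
    by (simp add: algebra_simps power2_eq_square)
  also have "[- (d\<^sup>2 * f\<^sup>2 * (- ?v)) = - ((- u) * f\<^sup>2 * e\<^sup>2)] (mod int p)"
    unfolding cong_minus_minus_iff by (intro cong_mult d cong_sym[OF e] cong_refl)
  also have "- ((- u) * f\<^sup>2 * e\<^sup>2) = u * (e * f)\<^sup>2" by (simp add: power2_eq_square)
  also have "[u * (e * f)\<^sup>2 = u * 1\<^sup>2] (mod int p)"
    by (intro cong_mult cong_pow f cong_refl)
  finally show ?thesis by auto
qed

section \<open>Points on circles\<close>

definition circle :: "nat \<Rightarrow> int \<Rightarrow> (int \<times> int) set" where
  "circle p u = {(x, y) \<in> {0..<int p} \<times> {0..<int p}. [x\<^sup>2 + y\<^sup>2 = u] (mod int p)}"

lemma finite_circle [simp]: "finite (circle p u)"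
  by (rule finite_subset[of _ "{0..<int p} \<times> {0..<int p}"]) (auto simp: circle_def)

lemma circle_cong: "[u = v] (mod int p) \<Longrightarrow> circle p u = circle p v"
  by (auto simp: circle_def cong_def)

text \<open>
  Write \<open>v = a\<^sup>2 + b\<^sup>2\<close>. Multiplication by \<open>a + b i\<close>, in coordinates, is injective since the
  norm \<open>v\<close> is invertible, and it multiplies norms by \<open>v\<close>.
\<close>

lemma card_circle_le_mult:
  fixes p :: nat and u v :: int
  assumes p: "prime p" "[p = 3] (mod 4)" and v: "\<not> int p dvd v"
  shows "card (circle p u) \<le> card (circle p (u * v))"
proof -
  let ?P = "int p"
  have P: "prime ?P" "?P > 0" using p(1) by (simp_all add: prime_gt_0_nat)
  obtain a b where ab: "[a\<^sup>2 + b\<^sup>2 = v] (mod ?P)" using ex_cong_sum_two_squares[OF p] by blast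
  have nab: "\<not> ?P dvd a\<^sup>2 + b\<^sup>2" using v cong_dvd_iff[OF ab] by simp
  define F where "F = (\<lambda>(x, y). ((a * x - b * y) mod ?P, (a * y + b * x) mod ?P))"
  have "F ` circle p u \<subseteq> circle p (u * v)"
  proof (rule image_subsetI)
    fix z assume "z \<in> circle p u"
    moreover obtain x y where z: "z = (x, y)" by fastforce
    ultimately have "(x, y) \<in> circle p u" by simp
    then have xy: "[x\<^sup>2 + y\<^sup>2 = u] (mod ?P)" by (simp add: circle_def)
    have "[((a * x - b * y) mod ?P)\<^sup>2 + ((a * y + b * x) mod ?P)\<^sup>2
        = (a * x - b * y)\<^sup>2 + (a * y + b * x)\<^sup>2] (mod ?P)"
      by (intro cong_add cong_pow) (simp_all add: cong_def)
    also have "(a * x - b * y)\<^sup>2 + (a * y + b * x)\<^sup>2 = (x\<^sup>2 + y\<^sup>2) * (a\<^sup>2 + b\<^sup>2)"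
      by (simp add: power2_eq_square algebra_simps)
    also have "[(x\<^sup>2 + y\<^sup>2) * (a\<^sup>2 + b\<^sup>2) = u * v] (mod ?P)" by (rule cong_mult[OF xy ab])
    finally show "F z \<in> circle p (u * v)" using P by (simp add: z circle_def F_def)
  qed
  moreover have "inj_on F (circle p u)"
  proof (rule inj_onI, clarify)
    fix x y x' y'
    assume mem: "(x, y) \<in> circle p u" "(x', y') \<in> circle p u" and eq: "F (x, y) = F (x', y')"
    have 1: "?P dvd (a * x - b * y) - (a * x' - b * y')"
      and 2: "?P dvd (a * y + b * x) - (a * y' + b * x')"
      using eq by (simp_all add: F_def mod_eq_dvd_iff)
    have "(a\<^sup>2 + b\<^sup>2) * (x - x') = a * ((a * x - b * y) - (a * x' - b * y'))
        + b * ((a * y + b * x) - (a * y' + b * x'))"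
      by (simp add: power2_eq_square algebra_simps)
    then have "?P dvd (a\<^sup>2 + b\<^sup>2) * (x - x')" using 1 2 by simp
    then have x: "?P dvd x - x'" using nab P(1) by (simp add: prime_dvd_mult_iff)
    have "(a\<^sup>2 + b\<^sup>2) * (y - y') = a * ((a * y + b * x) - (a * y' + b * x'))
        - b * ((a * x - b * y) - (a * x' - b * y'))"
      by (simp add: power2_eq_square algebra_simps)
    then have "?P dvd (a\<^sup>2 + b\<^sup>2) * (y - y')" using 1 2 by simp
    then have y: "?P dvd y - y'" using nab P(1) by (simp add: prime_dvd_mult_iff)
    show "x = x' \<and> y = y'"
      using x y mem by (simp add: circle_def mod_eq_dvd_iff[symmetric])
  qed
  ultimately show ?thesis by (metis card_inj_on_le finite_circle)
qed

text \<open>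
  Scaling by \<open>v\<close> and by its inverse shows that the circles of radius \<open>v\<close> and \<open>1\<close> have equally
  many points; the total number \<open>p\<^sup>2\<close> of points then determines this number.
\<close>

lemma card_circle:
  fixes p :: nat and u :: int
  assumes p: "prime p" "[p = 3] (mod 4)"
  shows "int (card (circle p u)) = int p + 1 - int p * of_bool (int p dvd u)"
proof -
  let ?P = "int p"
  have P: "prime ?P" "?P > 1" using p(1) prime_gt_1_nat[OF p(1)] by simp_all
  have "circle p 0 = {(0, 0)}"
  proof -
    have "x = 0 \<and> y = 0" if "(x, y) \<in> circle p 0" for x y
    proof -
      have "?P dvd x\<^sup>2 + y\<^sup>2" using that by (simp add: circle_def cong_0_iff)
      then have "?P dvd x" "?P dvd y"
        using dvd_sum_two_squaresD[OF p, of x y] dvd_sum_two_squaresD[OF p, of y x]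
        by (simp_all add: add.commute)
      then show ?thesis using that by (auto simp: circle_def dvd_eq_mod_eq_0)
    qed
    then show ?thesis using P by (auto simp: circle_def)
  qed
  then have zero: "card (circle p 0) = 1" by simp
  have nonzero: "card (circle p v) = card (circle p 1)" if v: "\<not> ?P dvd v" for v
  proof (rule antisym)
    have "coprime v ?P" using v P(1) prime_imp_coprime[of ?P v] by (simp add: coprime_commute)
    then obtain w where w: "[v * w = 1] (mod ?P)" using cong_solve_coprime_int by blast
    then have "\<not> ?P dvd w" using P cong_dvd_iff[OF w] by (auto dest: zdvd_imp_le)
    then show "card (circle p v) \<le> card (circle p 1)"
      using card_circle_le_mult[OF p, of w v] circle_cong[OF w] by simp
    show "card (circle p 1) \<le> card (circle p v)"
      using card_circle_le_mult[OF p v, of 1] by simp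
  qed
  \<comment> \<open>One circle of size one and \<open>p - 1\<close> circles of equal size partition the plane.\<close>
  have "{0..<?P} \<times> {0..<?P} = (\<Union>v\<in>{0..<?P}. circle p v)"
  proof (intro equalityI subsetI)
    fix z assume z: "z \<in> {0..<?P} \<times> {0..<?P}"
    then have "z \<in> circle p (((fst z)\<^sup>2 + (snd z)\<^sup>2) mod ?P)"
      by (auto simp: circle_def)
    moreover have "((fst z)\<^sup>2 + (snd z)\<^sup>2) mod ?P \<in> {0..<?P}" using P by simp
    ultimately show "z \<in> (\<Union>v\<in>{0..<?P}. circle p v)" by blast
  qed (auto simp: circle_def)
  moreover have "card (\<Union>v\<in>{0..<?P}. circle p v) = (\<Sum>v\<in>{0..<?P}. card (circle p v))"
    by (rule card_UN_disjoint, simp, simp, auto simp: circle_def cong_def)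
  ultimately have "(\<Sum>v\<in>{0..<?P}. card (circle p v)) = p * p"
    by (metis card_cartesian_product card_atLeastLessThan_int diff_zero nat_int)
  moreover have "{0..<?P} = insert 0 {1..<?P}" using P by auto
  moreover have "(\<Sum>v\<in>{1..<?P}. card (circle p v)) = (\<Sum>v\<in>{1..<?P}. card (circle p 1))"
    by (intro sum.cong refl nonzero) (auto dest: zdvd_imp_le)
  moreover have "nat (?P - 1) = p - 1" by arith
  ultimately have "1 + (p - 1) * card (circle p 1) = p * p"
    using zero by simp
  then have "1 + (?P - 1) * int (card (circle p 1)) = ?P * ?P"
    using P by (metis of_nat_1 of_nat_add of_nat_diff of_nat_mult prime_ge_1_nat[OF p(1)])
  then have "(?P - 1) * int (card (circle p 1)) = (?P - 1) * (?P + 1)" by (simp add: algebra_simps)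
  then have one: "int (card (circle p 1)) = ?P + 1" using P by simp
  show ?thesis
  proof (cases "?P dvd u")
    case True
    then have "circle p u = circle p 0" by (intro circle_cong) (simp add: cong_0_iff)
    then show ?thesis using zero True by simp
  qed (use nonzero one in simp)
qed

section \<open>Adjoining two squares\<close>

text \<open>
  The right-hand side \<open>u\<close> is an arbitrary integer, so that the recursion on the number of
  coordinates can subtract squares from it without reducing.
\<close>

definition sphere_card :: "nat \<Rightarrow> nat \<Rightarrow> int \<Rightarrow> nat" where
  "sphere_card p j u =
    card {x \<in> {1..j} \<rightarrow>\<^sub>E {0..<int p}. [(\<Sum>i\<in>{1..j}. (x i)\<^sup>2) = u] (mod int p)}"

lemma N_sq_eq_sphere_card:
  assumes "p > 1" and t: "t \<in> carrier (residue_ring (int p))"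
  shows "N_sq j t p = sphere_card p j t"
proof -
  interpret residues "int p" "residue_ring (int p)"
    using assms(1) by unfold_locales auto
  have carr: "carrier (residue_ring (int p)) = {0..<int p}" by (auto simp: res_carrier_eq)
  have "(\<Oplus>\<^bsub>residue_ring (int p)\<^esub>i\<in>{1..j}. x i [^]\<^bsub>residue_ring (int p)\<^esub> (2::nat))
      = (\<Sum>i\<in>{1..j}. (x i)\<^sup>2) mod int p" if "x \<in> {1..j} \<rightarrow>\<^sub>E {0..<int p}" for x
  proof -
    have "x i [^]\<^bsub>residue_ring (int p)\<^esub> (2::nat) = (x i)\<^sup>2 mod int p" if "i \<in> {1..j}" for i
    proof -
      have "x i mod int p = x i" using \<open>x \<in> _\<close> that by (fastforce simp: PiE_iff)
      then show ?thesis using pow_cong[of "x i" 2] by simp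
    qed
    then have "(\<Oplus>\<^bsub>residue_ring (int p)\<^esub>i\<in>{1..j}. x i [^]\<^bsub>residue_ring (int p)\<^esub> (2::nat))
      = (\<Oplus>\<^bsub>residue_ring (int p)\<^esub>i\<in>{1..j}. (x i)\<^sup>2 mod int p)"
      using assms(1) by (intro finsum_cong') (auto simp: carr)
    then show ?thesis by (simp add: sum_cong)
  qed
  then show ?thesis unfolding N_sq_def sphere_card_def carr
    using t by (intro arg_cong[of _ _ card]) (auto simp: cong_def carr)
qed

lemma sphere_card_Suc:
  "sphere_card p (Suc j) u = (\<Sum>a\<in>{0..<int p}. sphere_card p j (u - a\<^sup>2))"
proof -
  let ?A = "{0..<int p}"
  let ?S = "\<lambda>j u. {x \<in> {1..j} \<rightarrow>\<^sub>E ?A. [(\<Sum>i\<in>{1..j}. (x i)\<^sup>2) = u] (mod int p)}"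
  let ?f = "\<lambda>(a, g). g(Suc j := a)"
  have ins: "{1..Suc j} = insert (Suc j) {1..j}" by auto
  have upd: "(\<Sum>i\<in>{1..Suc j}. ((g(Suc j := a)) i)\<^sup>2) = a\<^sup>2 + (\<Sum>i\<in>{1..j}. (g i)\<^sup>2)"
    for g :: "nat \<Rightarrow> int" and a
    unfolding ins by (subst sum.insert) (auto intro!: sum.cong)
  have sol: "[a\<^sup>2 + s = u] (mod int p) \<longleftrightarrow> [s = u - a\<^sup>2] (mod int p)" for a s
    by (simp add: cong_iff_dvd_diff algebra_simps)
  have "?S (Suc j) u = ?f ` (SIGMA a:?A. ?S j (u - a\<^sup>2))"
  proof -
    have "?S (Suc j) u = {x \<in> ?f ` (?A \<times> ({1..j} \<rightarrow>\<^sub>E ?A)).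
        [(\<Sum>i\<in>{1..Suc j}. (x i)\<^sup>2) = u] (mod int p)}"
      unfolding ins by (simp only: PiE_insert_eq)
    also have "\<dots> = ?f ` {z \<in> ?A \<times> ({1..j} \<rightarrow>\<^sub>E ?A).
        [(\<Sum>i\<in>{1..Suc j}. (?f z i)\<^sup>2) = u] (mod int p)}"
      by blast
    also have "{z \<in> ?A \<times> ({1..j} \<rightarrow>\<^sub>E ?A). [(\<Sum>i\<in>{1..Suc j}. (?f z i)\<^sup>2) = u] (mod int p)}
        = (SIGMA a:?A. ?S j (u - a\<^sup>2))"
    proof (rule Set.set_eqI)
      fix z :: "int \<times> (nat \<Rightarrow> int)"
      obtain a g where z: "z = (a, g)" by fastforce
      show "z \<in> {z \<in> ?A \<times> ({1..j} \<rightarrow>\<^sub>E ?A). [(\<Sum>i\<in>{1..Suc j}. (?f z i)\<^sup>2) = u] (mod int p)}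
          \<longleftrightarrow> z \<in> (SIGMA a:?A. ?S j (u - a\<^sup>2))"
        by (simp only: z mem_Collect_eq mem_Sigma_iff prod.case upd sol conj_assoc)
    qed
    finally show ?thesis .
  qed
  moreover have "inj_on ?f (SIGMA a:?A. ?S j (u - a\<^sup>2))"
    by (rule inj_on_subset[OF inj_combinator[of "Suc j" "{1..j}" "\<lambda>_. ?A"]]) auto
  ultimately have "card (?S (Suc j) u) = card (SIGMA a:?A. ?S j (u - a\<^sup>2))"
    by (simp add: card_image)
  also have "\<dots> = (\<Sum>a\<in>?A. card (?S j (u - a\<^sup>2)))"
    by (rule card_SigmaI) (auto intro!: finite_Collect_conjI finite_PiE)
  finally show ?thesis unfolding sphere_card_def .
qed

text \<open>
  The factor \<open>p\<close> on the left keeps the formula integral for \<open>m = 0\<close>, where the induction starts.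
  In the step, the formula for \<open>m\<close> is summed over the last two coordinates \<open>a, b\<close>; its only
  dependence on them is whether \<open>a\<^sup>2 + b\<^sup>2 \<equiv> u\<close>, which is counted by the circle.
\<close>

lemma sphere_card_even:
  fixes p m :: nat and u :: int
  assumes p: "prime p" "[p = 3] (mod 4)"
  shows "int p * int (sphere_card p (2 * m) u)
    = int p ^ (2 * m) + (- int p) ^ m * (int p * of_bool (int p dvd u) - 1)"
proof (induction m arbitrary: u)
  case 0
  have "{x \<in> {1..0::nat} \<rightarrow>\<^sub>E {0..<int p}. [(\<Sum>i\<in>{1..0}. (x i)\<^sup>2) = u] (mod int p)}
      = (if int p dvd u then {\<lambda>_. undefined} else {})"
    by (auto simp: cong_iff_dvd_diff)
  then show ?case by (simp add: sphere_card_def)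
next
  case (Suc m)
  let ?P = "int p" and ?A = "{0..<int p}"
  let ?B = "(- ?P) ^ m"
  have circ: "(\<Sum>z\<in>?A \<times> ?A. of_bool (?P dvd u - (fst z)\<^sup>2 - (snd z)\<^sup>2)) = int (card (circle p u))"
  proof -
    have "circle p u = {z \<in> ?A \<times> ?A. ?P dvd u - (fst z)\<^sup>2 - (snd z)\<^sup>2}"
      by (auto simp: circle_def cong_sym_eq[of _ u] cong_iff_dvd_diff algebra_simps)
    then show ?thesis by (simp add: sum.If_cases of_bool_def Int_def)
  qed
  have linear: "(\<Sum>z\<in>?A \<times> ?A. ?P ^ (2 * m) + ?B * (?P * g z - 1))
      = ?P\<^sup>2 * (?P ^ (2 * m) - ?B) + ?B * ?P * (\<Sum>z\<in>?A \<times> ?A. g z)" for g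
    by (simp add: sum.distrib sum_subtractf sum_distrib_left algebra_simps power2_eq_square)
  have "?P * int (sphere_card p (2 * Suc m) u)
      = (\<Sum>a\<in>?A. \<Sum>b\<in>?A. ?P * int (sphere_card p (2 * m) (u - a\<^sup>2 - b\<^sup>2)))"
    by (simp add: sphere_card_Suc sum_distrib_left)
  also have "\<dots> = (\<Sum>z\<in>?A \<times> ?A. ?P ^ (2 * m)
      + ?B * (?P * of_bool (?P dvd u - (fst z)\<^sup>2 - (snd z)\<^sup>2) - 1))"
    by (simp add: Suc.IH sum.cartesian_product case_prod_beta)
  also have "\<dots> = ?P\<^sup>2 * (?P ^ (2 * m) - ?B) + ?B * ?P * int (card (circle p u))"
    by (simp only: linear circ)
  also have "\<dots> = ?P\<^sup>2 * (?P ^ (2 * m) - ?B) + ?B * ?P * (?P + 1 - ?P * of_bool (?P dvd u))"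
    by (simp only: card_circle[OF p])
  also have "\<dots> = ?P ^ (2 * Suc m) + (- ?P) ^ Suc m * (?P * of_bool (?P dvd u) - 1)"
    by (simp add: algebra_simps power2_eq_square)
  finally show ?case .
qed

theorem theorem1p8:
  fixes p m :: nat and t :: int
  assumes "prime p" and "odd p" and "[p = 3] (mod 4)"
    and "m \<ge> 1"
    and "t \<in> carrier (residue_ring (int p))"
  shows "int (N_sq (2 * m) t p) =
    (if t = \<zero>\<^bsub>residue_ring (int p)\<^esub>
     then int p ^ (2 * m - 1) + (- 1) ^ m * int p ^ m + (- 1) ^ (m - 1) * int p ^ (m - 1)
     else int p ^ (2 * m - 1) + (- 1) ^ (m - 1) * int p ^ (m - 1))"
proof -
  let ?P = "int p"
  have p1: "p > 1" using assms(1) by (rule prime_gt_1_nat)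
  interpret residues ?P "residue_ring ?P" using p1 by unfold_locales auto
  obtain k where m: "m = Suc k" using assms(4) by (cases m) auto
  have t: "?P dvd t \<longleftrightarrow> t = 0"
    using assms(5) by (auto simp: res_carrier_eq dest: zdvd_imp_le)
  have "?P * int (N_sq (2 * m) t p) =
      ?P ^ (2 * m) + (- ?P) ^ m * (?P * of_bool (t = 0) - 1)"
    using sphere_card_even[OF assms(1,3), of m t] N_sq_eq_sphere_card[OF p1 assms(5)]
    by (simp add: t)
  also have "\<dots> = ?P * (?P ^ (2 * m - 1) + (- 1) ^ m * ?P ^ m * of_bool (t = 0)
      + (- 1) ^ (m - 1) * ?P ^ (m - 1))"
    by (simp add: m algebra_simps power_minus[of ?P])
  finally have "int (N_sq (2 * m) t p) = ?P ^ (2 * m - 1)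
      + (- 1) ^ m * ?P ^ m * of_bool (t = 0) + (- 1) ^ (m - 1) * ?P ^ (m - 1)"
    using p1 by simp
  then show ?thesis by (simp add: res_zero_eq)
qed

end
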